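(* Let $L>0$ be an integer and let $y>1$ be an odd integer. Define the integers $a(L,y,n)$, $n\ge 1$, by \[ \frac{1}{(q,q^{y+2},q^{2y};q^{2y+2})_L} - \frac{1}{(q^2,q^{y},q^{2y+1};q^{2y+2})_L} = \sum_{n=1}^\infty a(L,y,n)\, q^{n}. \] Then $a(L,y,n)\ge 0$ for all $n\ge 1$. Furthermore, $a(L,y,n)=0$ if and only if either $n\in\{2,4,6,\dots,y+1\}\cup\{y\}$ or $(L,y,n)=(1,3,9)$.
   Context: For an integer $L\ge 0$, $(a;q)_L=1$ if $L=0$ and $(a;q)_L=\prod_{j=0}^{L-1}(1-aq^j)$ if $L>0$; and $(a_1,\dots,a_k;q)_L=(a_1;q)_L\cdots(a_k;q)_L$. Equivalently, $a(L,y,n)=P_1(L,y,n)-P_2(L,y,n)$, where $P_1(L,y,n)$ is the number of partitions of $n$ into parts congruent to $1$, $y+2$, or $2y \pmod{2y+2}$ with largest part at most $(2y+2)L-2$, and $P_2(L,y,n)$ is the number of partitions of $n$ into parts congruent to $2$, $y$, or $2y+1 \pmod{2y+2}$ with largest part at most $(2y+2)L-1$. *)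

theory Defs
  imports "HOL-Computational_Algebra.Formal_Power_Series"
begin

definition qpoch :: "nat \<Rightarrow> nat \<Rightarrow> nat \<Rightarrow> rat fps" where
  "qpoch e s L = (\<Prod>j<L. 1 - fps_X ^ (e + s * j))"

definition acoef :: "nat \<Rightarrow> nat \<Rightarrow> nat \<Rightarrow> rat" where
  "acoef L y n = fps_nth
     (inverse (qpoch 1 (2*y+2) L * qpoch (y+2) (2*y+2) L * qpoch (2*y) (2*y+2) L)
      - inverse (qpoch 2 (2*y+2) L * qpoch y (2*y+2) L * qpoch (2*y+1) (2*y+2) L)) n"

end

theory Submission
  imports Defs
begin

text \<open>
  Put \<open>h = y + 1\<close>, \<open>u\<^sub>m = q\<^bsup>mh+1\<^esup>\<close> and \<open>v\<^sub>m = q\<^bsup>mh+y\<^esup>\<close>. The first denominator is the product of the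
  \<open>1 - u\<^sub>m\<close> (\<open>m < 2L\<close>) and the \<open>1 - v\<^sub>m\<^sup>2\<close> (\<open>m < L\<close>); the second one arises by exchanging \<open>u\<close> and
  \<open>v\<close>. Writing \<open>1/(1 - x) = (1 + x)/(1 - x\<^sup>2)\<close> for the factors with \<open>m < L\<close> makes the squared factors
  common, so the difference is a positive series times \<open>\<Prod>\<alpha>\<^sub>m - \<Prod>\<beta>\<^sub>m\<close>, where \<open>\<alpha>\<^sub>m\<close> is \<open>1 + u\<^sub>m\<close> for
  \<open>m < L\<close> and \<open>1/(1 - u\<^sub>m)\<close> for \<open>L \<le> m < 2L\<close>, and likewise \<open>\<beta>\<^sub>m\<close> with \<open>v\<close>. As \<open>v\<^sub>m = u\<^sub>m q\<^bsup>y-1\<^esup>\<close>, each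
  \<open>\<alpha>\<^sub>m - \<beta>\<^sub>m\<close> is \<open>1 - q\<^bsup>y-1\<^esup>\<close> times a series with nonnegative coefficients; telescoping gives the
  same for \<open>\<Prod>\<alpha>\<^sub>m - \<Prod>\<beta>\<^sub>m\<close>. Since \<open>y - 1\<close> is even, the common factor \<open>1/(1 - u\<^sub>0\<^sup>2) = 1/(1 - q\<^sup>2)\<close> turns
  \<open>1 - q\<^bsup>y-1\<^esup>\<close> into \<open>1 + q\<^sup>2 + \<dots> + q\<^bsup>y-3\<^esup>\<close>. The zeros are then read off from the support of
  the resulting manifestly nonnegative product.
\<close>

unbundle fps_syntax

section \<open>Power series with nonnegative coefficients\<close>

definition fps_nonneg :: "'a::linordered_idom fps \<Rightarrow> bool" where
  "fps_nonneg f \<longleftrightarrow> (\<forall>n. 0 \<le> f $ n)"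

lemma fps_nonneg_nth: "fps_nonneg f \<Longrightarrow> 0 \<le> f $ n"
  by (simp add: fps_nonneg_def)

lemma fps_nonneg_0 [simp]: "fps_nonneg 0"
  and fps_nonneg_1 [simp]: "fps_nonneg 1"
  and fps_nonneg_X_power [simp]: "fps_nonneg (fps_X ^ k)"
  by (auto simp: fps_nonneg_def)

lemma fps_nonneg_add [intro]: "fps_nonneg f \<Longrightarrow> fps_nonneg g \<Longrightarrow> fps_nonneg (f + g)"
  by (simp add: fps_nonneg_def)

lemma fps_nonneg_mult [intro]: "fps_nonneg f \<Longrightarrow> fps_nonneg g \<Longrightarrow> fps_nonneg (f * g)"
  by (simp add: fps_nonneg_def fps_mult_nth sum_nonneg)

lemma fps_nonneg_prod: "(\<And>i. i \<in> I \<Longrightarrow> fps_nonneg (f i)) \<Longrightarrow> fps_nonneg (prod f I)"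
  by (induction I rule: infinite_finite_induct) auto

lemma fps_mult_nth_pos:
  assumes "fps_nonneg f" "fps_nonneg g" "f $ i > 0" "g $ j > 0"
  shows "(f * g) $ (i + j) > 0"
  unfolding fps_mult_nth
  by (rule sum_pos2[of _ i]) (use assms in \<open>auto simp: fps_nonneg_def\<close>)

lemma inverse_one_minus_X_power_nth:
  assumes "k > 0"
  shows "inverse (1 - fps_X ^ k :: 'a::field fps) $ n = (if k dvd n then 1 else 0)"
proof -
  let ?g = "Abs_fps (\<lambda>n. if k dvd n then 1 else 0) :: 'a fps"
  have "(1 - fps_X ^ k) * ?g = 1"
  proof (rule fps_ext)
    fix n
    show "((1 - fps_X ^ k) * ?g) $ n = 1 $ n"
      using assms by (auto simp: left_diff_distrib fps_X_power_mult_nth dvd_diff_nat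
          dest: nat_dvd_not_less le_imp_diff_is_add)
         (metis dvd_add_triv_right_iff le_add_diff_inverse2 not_less)+
  qed
  then have "inverse (1 - fps_X ^ k) = ?g"
    using fps_inverse_unique by blast
  then show ?thesis by simp
qed

lemma fps_nonneg_inverse_one_minus_X_power:
  "k > 0 \<Longrightarrow> fps_nonneg (inverse (1 - fps_X ^ k :: rat fps))"
  by (simp add: fps_nonneg_def inverse_one_minus_X_power_nth)

lemma inverse_prod_fps: "inverse (prod f I) = (\<Prod>i\<in>I. inverse (f i :: 'a::field fps))"
  by (induction I rule: infinite_finite_induct) (auto simp: fps_inverse_mult)

section \<open>Factoring the difference of the two series\<close>

definition split_factor :: "nat \<Rightarrow> (nat \<Rightarrow> rat fps) \<Rightarrow> nat \<Rightarrow> rat fps" where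
  "split_factor L t m = (if m < L then 1 + t m else inverse (1 - t m))"

lemma inverse_prod_split:
  assumes "\<And>m. t m $ 0 = (0::rat)"
  shows "inverse (\<Prod>m<2*L. 1 - t m)
       = (\<Prod>m<2*L. split_factor L t m) * inverse (\<Prod>m<L. 1 - t m ^ 2)"
proof -
  have *: "inverse (1 - t m) = (1 + t m) * inverse (1 - t m ^ 2)" for m
  proof -
    have "1 - t m ^ 2 = (1 - t m) * (1 + t m)" by (simp add: algebra_simps power2_eq_square)
    then have "(1 + t m) * inverse (1 - t m ^ 2)
        = inverse (1 - t m) * ((1 + t m) * inverse (1 + t m))"
      by (simp only: fps_inverse_mult mult_ac)
    also have "(1 + t m) * inverse (1 + t m) = 1"
      using assms[of m] by (intro inverse_mult_eq_1') simp
    finally show ?thesis by simp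
  qed
  have "{..<2*L} = {..<L} \<union> {L..<2*L}" by auto
  then have un: "prod f {..<2*L} = prod f {..<L} * prod f {L..<2*L}" for f :: "nat \<Rightarrow> rat fps"
    by (simp add: prod.union_disjoint ivl_disj_int)
  have "inverse (\<Prod>m<2*L. 1 - t m) = (\<Prod>m<L. inverse (1 - t m)) * (\<Prod>m=L..<2*L. inverse (1 - t m))"
    by (simp only: un fps_inverse_mult inverse_prod_fps)
  also have "(\<Prod>m<L. inverse (1 - t m)) = (\<Prod>m<L. split_factor L t m) * (\<Prod>m<L. inverse (1 - t m ^ 2))"
    by (simp add: prod.distrib [symmetric] split_factor_def) (rule prod.cong, auto simp: *)
  also have "(\<Prod>m=L..<2*L. inverse (1 - t m)) = (\<Prod>m=L..<2*L. split_factor L t m)"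
    by (rule prod.cong) (auto simp: split_factor_def)
  finally show ?thesis unfolding un[of "split_factor L t"] inverse_prod_fps by (simp only: mult_ac)
qed

text \<open>The two progressions of step \<open>2*s\<close> are the even-indexed and odd-indexed
  terms of one progression of step \<open>s\<close>.\<close>

lemma qpoch_interlace:
  assumes "e' = e + s"
  shows "qpoch e (2*s) L * qpoch e' (2*s) L = (\<Prod>m<2*L. 1 - fps_X ^ (m*s + e))"
  unfolding qpoch_def assms by (induction L) (simp_all add: algebra_simps)

lemma qpoch_double: "qpoch (2*e) (2*s) L = (\<Prod>m<L. 1 - (fps_X ^ (m*s + e))^2)"
  unfolding qpoch_def by (simp add: power_mult [symmetric] algebra_simps)

definition low_term :: "nat \<Rightarrow> nat \<Rightarrow> rat fps" where "low_term y m = fps_X ^ (m*(y+1) + 1)"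
definition high_term :: "nat \<Rightarrow> nat \<Rightarrow> rat fps" where "high_term y m = fps_X ^ (m*(y+1) + y)"

text \<open>For m >= L this comes from 1/(1-u) - 1/(1-v) = (u-v)/((1-u)(1-v)) with u - v = u(1 -
  q^(y-1)).\<close>

definition factor_diff_quot :: "nat \<Rightarrow> nat \<Rightarrow> nat \<Rightarrow> rat fps" where
  "factor_diff_quot L y m = (if m < L then low_term y m
     else low_term y m * (inverse (1 - low_term y m) * inverse (1 - high_term y m)))"

text \<open>The recursion is Aa - Bb = (A-B)b + A(a-b) with 1 - q^(y-1) already divided out, so that
  no subtraction remains.\<close>

fun telescoped :: "nat \<Rightarrow> nat \<Rightarrow> nat \<Rightarrow> rat fps" where
  "telescoped L y 0 = 0"
| "telescoped L y (Suc k) = telescoped L y k * split_factor L (high_term y) k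
     + (\<Prod>m<k. split_factor L (low_term y) m) * factor_diff_quot L y k"

lemma high_term_eq: "y > 0 \<Longrightarrow> high_term y m = low_term y m * fps_X ^ (y - 1)"
  by (simp add: low_term_def high_term_def flip: power_add power_Suc)

lemma split_factor_diff:
  assumes "y > 0"
  shows "split_factor L (low_term y) m - split_factor L (high_term y) m
       = (1 - fps_X ^ (y - 1)) * factor_diff_quot L y m"
proof (cases "m < L")
  case True
  then show ?thesis using assms
    by (simp add: split_factor_def factor_diff_quot_def high_term_eq algebra_simps)
next
  case False
  let ?a = "1 - low_term y m" and ?b = "1 - high_term y m"
  have a: "?a * inverse ?a = 1" and b: "?b * inverse ?b = 1"
    using assms by (simp_all add: inverse_mult_eq_1' low_term_def high_term_def)
  have "inverse ?a - inverse ?b = (?b * inverse ?b) * inverse ?a - (?a * inverse ?a) * inverse ?b"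
    by (simp only: a b mult_1_left)
  also have "\<dots> = (?b - ?a) * (inverse ?a * inverse ?b)" by (simp only: algebra_simps)
  also have "?b - ?a = (1 - fps_X ^ (y - 1)) * low_term y m"
    using assms by (simp add: high_term_eq algebra_simps)
  finally show ?thesis using False
    by (simp add: split_factor_def factor_diff_quot_def mult.assoc)
qed

lemma prod_split_factor_diff:
  assumes "y > 0"
  shows "(\<Prod>m<k. split_factor L (low_term y) m) - (\<Prod>m<k. split_factor L (high_term y) m)
       = (1 - fps_X ^ (y - 1)) * telescoped L y k"
proof (induction k)
  case (Suc k)
  let ?A = "\<Prod>m<k. split_factor L (low_term y) m" and ?B = "\<Prod>m<k. split_factor L (high_term y) m"
  let ?a = "split_factor L (low_term y) k" and ?b = "split_factor L (high_term y) k"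
  have "?A * ?a - ?B * ?b = (?A - ?B) * ?b + ?A * (?a - ?b)" by (simp add: algebra_simps)
  then show ?case using Suc split_factor_diff[OF assms, of L k]
    by (simp add: algebra_simps)
qed simp

definition even_block :: "nat \<Rightarrow> rat fps" where "even_block y = (\<Sum>i<(y-1) div 2. fps_X ^ (2*i))"

text \<open>The first product starts at m = 1: the factor 1/(1-q^2) for m = 0 is spent on turning 1
  - q^(y-1) into \<open>even_block y\<close>.\<close>

definition common_factor :: "nat \<Rightarrow> nat \<Rightarrow> rat fps" where
  "common_factor L y = (\<Prod>m=1..<L. inverse (1 - low_term y m ^ 2)) * (\<Prod>m<L. inverse (1 - high_term y m ^ 2))"

lemma acoef_eq:
  assumes "L > 0" "odd y"
  shows "acoef L y n = (even_block y * common_factor L y * telescoped L y (2*L)) $ n"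
proof -
  have y: "y > 0" using assms by (auto elim: oddE)
  then have low0: "low_term y m $ 0 = 0" and high0: "high_term y m $ 0 = 0" for m
    by (simp_all add: low_term_def high_term_def)
  let ?U = "inverse (\<Prod>m<L. 1 - low_term y m ^ 2)" and ?V = "inverse (\<Prod>m<L. 1 - high_term y m ^ 2)"
  have 1: "qpoch 1 (2*y+2) L * qpoch (y+2) (2*y+2) L * qpoch (2*y) (2*y+2) L
     = (\<Prod>m<2*L. 1 - low_term y m) * (\<Prod>m<L. 1 - high_term y m ^ 2)"
    using qpoch_interlace[of "y+2" 1 "y+1" L] qpoch_double[of y "y+1" L]
    by (simp add: low_term_def high_term_def)
  have 2: "qpoch 2 (2*y+2) L * qpoch y (2*y+2) L * qpoch (2*y+1) (2*y+2) L
     = (\<Prod>m<2*L. 1 - high_term y m) * (\<Prod>m<L. 1 - low_term y m ^ 2)"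
    using qpoch_interlace[of "2*y+1" y "y+1" L] qpoch_double[of 1 "y+1" L]
    by (simp add: low_term_def high_term_def mult.assoc mult.commute)
  have "inverse ((\<Prod>m<2*L. 1 - low_term y m) * (\<Prod>m<L. 1 - high_term y m ^ 2))
      - inverse ((\<Prod>m<2*L. 1 - high_term y m) * (\<Prod>m<L. 1 - low_term y m ^ 2))
      = ?U * ?V * ((\<Prod>m<2*L. split_factor L (low_term y) m) - (\<Prod>m<2*L. split_factor L (high_term y) m))"
    unfolding fps_inverse_mult inverse_prod_split[of "low_term y", OF low0]
      inverse_prod_split[of "high_term y", OF high0]
    by (simp add: algebra_simps)
  also have "\<dots> = ?U * ?V * ((1 - fps_X ^ (y - 1)) * telescoped L y (2*L))"
    by (simp only: prod_split_factor_diff[OF y])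
  also have "?U = inverse (1 - fps_X ^ 2) * (\<Prod>m=1..<L. inverse (1 - low_term y m ^ 2))"
    using assms unfolding inverse_prod_fps lessThan_atLeast0
    by (subst prod.atLeast_Suc_lessThan) (simp_all add: low_term_def)
  also have "1 - fps_X ^ (y - 1) = (1 - fps_X ^ 2 :: rat fps) * even_block y"
  proof -
    have "y - 1 = 2 * ((y-1) div 2)" using assms by (auto elim: oddE)
    then show ?thesis unfolding even_block_def
      by (metis (no_types, lifting) one_diff_power_eq power_mult sum.cong)
  qed
  finally have "acoef L y n = ((inverse (1 - fps_X ^ 2) * (1 - fps_X ^ 2))
      * (even_block y * common_factor L y * telescoped L y (2*L))) $ n"
    unfolding acoef_def 1 2 common_factor_def inverse_prod_fps by (simp only: mult_ac)
  moreover have "inverse (1 - fps_X ^ 2) * (1 - fps_X ^ 2 :: rat fps) = 1"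
    by (intro inverse_mult_eq_1) simp
  ultimately show ?thesis by simp
qed

section \<open>Nonnegativity of the factors\<close>

lemma low_high_term_nonneg [simp]: "fps_nonneg (low_term y m)" "fps_nonneg (high_term y m)"
  by (simp_all only: low_term_def high_term_def fps_nonneg_X_power)

lemma split_factor_X_power_nth:
  assumes "t m = fps_X ^ e" "e > 0"
  shows "split_factor L t m $ n
       = (if m < L then if n = 0 \<or> n = e then 1 else 0 else if e dvd n then 1 else 0)"
  using assms by (auto simp: split_factor_def inverse_one_minus_X_power_nth)

lemma split_factor_nonneg:
  assumes "t m = fps_X ^ e" "e > 0"
  shows "fps_nonneg (split_factor L t m)"
  by (simp add: fps_nonneg_def split_factor_X_power_nth[of t m e, OF assms])

lemma split_factor_low_high_nonneg:
  assumes "y > 0"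
  shows "fps_nonneg (split_factor L (low_term y) m)" "fps_nonneg (split_factor L (high_term y) m)"
  using assms by (auto intro!: split_factor_nonneg low_term_def high_term_def)

lemma factor_diff_quot_nonneg:
  assumes "y > 0"
  shows "fps_nonneg (factor_diff_quot L y m)"
  unfolding factor_diff_quot_def using assms
  by (auto intro!: fps_nonneg_mult fps_nonneg_inverse_one_minus_X_power
      simp del: power_Suc simp: low_term_def high_term_def)

lemma telescoped_nonneg:
  assumes "y > 0"
  shows "fps_nonneg (telescoped L y k)"
  using assms
  by (induction k) (auto intro!: fps_nonneg_add fps_nonneg_mult fps_nonneg_prod
      split_factor_low_high_nonneg factor_diff_quot_nonneg)

lemma even_block_nth: "even_block y $ n = (if even n \<and> n div 2 < (y - 1) div 2 then 1 else 0)"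
proof -
  have "even_block y $ n = (\<Sum>i<(y-1) div 2. if n div 2 = i then if even n then 1 else 0 else 0)"
    unfolding even_block_def fps_sum_nth by (rule sum.cong) auto
  then show ?thesis by (simp add: sum.delta')
qed

lemma even_block_nonneg: "fps_nonneg (even_block y)"
  by (simp add: fps_nonneg_def even_block_nth)

lemma common_factor_nonneg:
  assumes "y > 0"
  shows "fps_nonneg (common_factor L y)"
  unfolding common_factor_def low_term_def high_term_def power_mult [symmetric] using assms
  by (intro fps_nonneg_mult fps_nonneg_prod fps_nonneg_inverse_one_minus_X_power) auto

section \<open>Exponents in the support\<close>

lemma fps_prod_nth_0: "prod f I $ 0 = (\<Prod>i\<in>I. f i $ 0)"
  by (induction I rule: infinite_finite_induct) auto

text \<open>The factor with v_0^2 = q^(2y) supplies every multiple of 2y; all others contribute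
  their constant term 1.\<close>

lemma common_factor_nth_pos:
  assumes "L > 0" "y > 0"
  shows "common_factor L y $ (c * (2*y)) > 0"
proof -
  let ?r = "\<lambda>m. inverse (1 - high_term y m ^ 2)"
  have nonneg: "fps_nonneg (?r m)" "fps_nonneg (inverse (1 - low_term y m ^ 2))" for m
    unfolding low_term_def high_term_def power_mult [symmetric] using assms
    by (intro fps_nonneg_inverse_one_minus_X_power; simp)+
  have "?r 0 $ (c * (2*y)) > 0"
    using assms unfolding high_term_def power_mult [symmetric]
    by (subst inverse_one_minus_X_power_nth) (auto simp: mult.commute)
  moreover have "(\<Prod>m=1..<L. ?r m) $ 0 > 0" "(\<Prod>m=1..<L. inverse (1 - low_term y m ^ 2)) $ 0 > 0"
    using assms by (auto simp: fps_prod_nth_0 low_term_def high_term_def simp flip: power_mult power_Suc intro!: prod_pos)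
  ultimately have "((\<Prod>m=1..<L. inverse (1 - low_term y m ^ 2)) * (?r 0 * (\<Prod>m=1..<L. ?r m)))
      $ (0 + (c * (2*y) + 0)) > 0"
    by (intro fps_mult_nth_pos fps_nonneg_mult fps_nonneg_prod nonneg)
  moreover have "(\<Prod>m<L. ?r m) = ?r 0 * (\<Prod>m=1..<L. ?r m)"
    using assms by (simp add: lessThan_atLeast0 prod.atLeast_Suc_lessThan)
  ultimately show ?thesis by (simp add: common_factor_def)
qed

text \<open>The positivity criterion: nothing cancels among nonnegative series, so \<open>n\<close>
  only has to be a sum of one exponent from each of the three factors.\<close>

lemma acoef_pos:
  assumes "L > 0" "odd y" "telescoped L y (2*L) $ t > 0" "i < (y - 1) div 2" "n = t + 2*i + c * (2*y)"
  shows "acoef L y n > 0"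
proof -
  have y: "y > 0" using assms by (auto elim: oddE)
  have "(even_block y * common_factor L y * telescoped L y (2*L)) $ (2*i + c * (2*y) + t) > 0"
    using assms y by (intro fps_mult_nth_pos fps_nonneg_mult even_block_nonneg common_factor_nonneg
        telescoped_nonneg common_factor_nth_pos) (auto simp: even_block_nth)
  then show ?thesis using assms by (simp add: acoef_eq add_ac)
qed

lemma telescoped_Suc_pos:
  assumes "y > 0"
  shows telescoped_Suc_pos_left: "telescoped L y k $ i > 0 \<Longrightarrow> split_factor L (high_term y) k $ j > 0
           \<Longrightarrow> telescoped L y (Suc k) $ (i + j) > 0"
    and telescoped_Suc_pos_right: "(\<Prod>m<k. split_factor L (low_term y) m) $ i > 0
           \<Longrightarrow> factor_diff_quot L y k $ j > 0 \<Longrightarrow> telescoped L y (Suc k) $ (i + j) > 0"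
proof -
  have nonneg: "fps_nonneg (\<Prod>m<k. split_factor L (low_term y) m)"
    using assms by (intro fps_nonneg_prod split_factor_low_high_nonneg)
  note all = nonneg telescoped_nonneg[OF assms] split_factor_low_high_nonneg[OF assms]
    factor_diff_quot_nonneg[OF assms]
  show "telescoped L y (Suc k) $ (i + j) > 0"
    if "telescoped L y k $ i > 0" "split_factor L (high_term y) k $ j > 0"
    using fps_mult_nth_pos[OF _ _ that] all
    by (auto intro!: add_pos_nonneg fps_nonneg_nth fps_nonneg_mult)
  show "telescoped L y (Suc k) $ (i + j) > 0"
    if "(\<Prod>m<k. split_factor L (low_term y) m) $ i > 0" "factor_diff_quot L y k $ j > 0"
    using fps_mult_nth_pos[OF _ _ that] all
    by (auto intro!: add_nonneg_pos fps_nonneg_nth fps_nonneg_mult)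
qed

text \<open>Later factors \<open>split_factor L (high_term y) k\<close> have constant term 1, so an
  exponent found at an early stage survives to stage \<open>2*L\<close>.\<close>

lemma telescoped_pos_mono:
  assumes "y > 0" "telescoped L y k $ n > 0" "k \<le> k'"
  shows "telescoped L y k' $ n > 0"
  using assms(3,2)
proof (induction rule: dec_induct)
  case (step k)
  have "split_factor L (high_term y) k $ 0 > 0"
    using assms(1) by (simp add: split_factor_X_power_nth[OF high_term_def])
  then show ?case using telescoped_Suc_pos_left[OF assms(1), of L k n 0] step by simp
qed

text \<open>The exponents are those of u_m and of u_m^2, the latter using the geometric series
  1/(1-u_m).\<close>

lemma factor_diff_quot_pos:
  assumes "y > 0"
  shows "factor_diff_quot L y m $ (m*(y+1) + 1) > 0"
    and "m \<ge> L \<Longrightarrow> factor_diff_quot L y m $ (2 * (m*(y+1) + 1)) > 0"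
proof -
  let ?e = "m*(y+1) + 1"
  have inv: "fps_nonneg (inverse (1 - low_term y m))" "fps_nonneg (inverse (1 - high_term y m))"
    unfolding low_term_def high_term_def using assms by (intro fps_nonneg_inverse_one_minus_X_power; simp)+
  have nth: "inverse (1 - low_term y m) $ ?e = 1"
    "inverse (1 - low_term y m) $ 0 = 1" "inverse (1 - high_term y m) $ 0 = 1"
    "low_term y m $ ?e = 1"
    unfolding low_term_def high_term_def using assms
    by (simp_all add: inverse_one_minus_X_power_nth del: power_Suc fps_inverse_nth_0)
  have "(low_term y m * (inverse (1 - low_term y m) * inverse (1 - high_term y m))) $ (?e + (?e + 0)) > 0"
       "(low_term y m * (inverse (1 - low_term y m) * inverse (1 - high_term y m))) $ (?e + (0 + 0)) > 0"
    by (intro fps_mult_nth_pos inv low_high_term_nonneg fps_nonneg_mult; simp only: nth zero_less_one)+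
  then show "factor_diff_quot L y m $ ?e > 0"
    "m \<ge> L \<Longrightarrow> factor_diff_quot L y m $ (2 * ?e) > 0"
    using nth by (auto simp: factor_diff_quot_def mult_2 add_ac)
qed

text \<open>With u_0 = q, u_1 = q^(y+2), v_1 = q^(2y+1) and u_2 = q^(2y+3), the exponents arise from
  u_0, (1+u_0)u_1 and u_0 v_1; for L = 1 also from (1+u_0)u_1^2 and u_0 v_1^2, and for L >= 2 from
  (1+u_0)u_2.\<close>

lemma telescoped_support:
  assumes "L > 0" "y > 0"
  shows "telescoped L y (2*L) $ 1 > 0" "telescoped L y (2*L) $ (y+2) > 0" "telescoped L y (2*L) $ (y+3) > 0"
    "telescoped L y (2*L) $ (2*y+2) > 0" "telescoped L y (2*L) $ (2*y+4) > 0"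
    "L \<ge> 2 \<Longrightarrow> telescoped L y (2*L) $ (2*y+3) > 0"
    "L = 1 \<Longrightarrow> telescoped L y (2*L) $ (2*y+5) > 0"
    "L = 1 \<Longrightarrow> telescoped L y (2*L) $ (4*y+3) > 0"
proof -
  note left = telescoped_Suc_pos_left[OF assms(2)] and right = telescoped_Suc_pos_right[OF assms(2)]
  have "Suc 1 \<le> 2 * L" using assms by simp
  note up = telescoped_pos_mono[OF assms(2) _ this]
  have t1: "telescoped L y 1 $ 1 > 0"
    using assms by (simp add: factor_diff_quot_def low_term_def)
  then show "telescoped L y (2*L) $ 1 > 0"
    using assms by (intro telescoped_pos_mono[OF assms(2) t1]) auto
  have p0: "(\<Prod>m<1. split_factor L (low_term y) m) = 1 + fps_X"
    using assms by (simp add: split_factor_def low_term_def)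
  have "telescoped L y (Suc 1) $ (i + j) > 0" if "i = 0 \<or> i = 1" "factor_diff_quot L y 1 $ j > 0" for i j
    using that by (intro right) (auto simp: p0 simp del: prod.lessThan_Suc One_nat_def)
  note t2 = this
  note quot = factor_diff_quot_pos[OF assms(2), of L 1]
  show "telescoped L y (2*L) $ (y+2) > 0" "telescoped L y (2*L) $ (y+3) > 0"
    using up[OF t2[OF _ quot(1), of 0]] up[OF t2[OF _ quot(1), of 1]] by (simp_all add: numeral_3_eq_3)
  have h1: "split_factor L (high_term y) 1 $ (2*y+1) > 0" "L = 1 \<Longrightarrow> split_factor L (high_term y) 1 $ (4*y+2) > 0"
    using split_factor_X_power_nth[of "high_term y" 1 "2*y+1" L] by (auto simp: high_term_def intro: dvdI[of _ _ 2])
  show "telescoped L y (2*L) $ (2*y+2) > 0"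
    using up[OF left[OF t1 h1(1)]] by simp
  show "L = 1 \<Longrightarrow> telescoped L y (2*L) $ (4*y+3) > 0"
    using up[OF left[OF t1 h1(2)]] by (simp add: numeral_3_eq_3 del: telescoped.simps)
  have one: "telescoped L y (2*L) $ (2*y+4) > 0" "telescoped L y (2*L) $ (2*y+5) > 0" if "L = 1"
  proof -
    have "0 + 2*(1*(y+1)+1) = 2*y+4" "1 + 2*(1*(y+1)+1) = 2*y+5" by simp_all
    then show "telescoped L y (2*L) $ (2*y+4) > 0" "telescoped L y (2*L) $ (2*y+5) > 0"
      using up[OF t2[OF _ quot(2), of 0]] up[OF t2[OF _ quot(2), of 1]] that by (metis order_refl)+
  qed
  have ge2: "telescoped L y (2*L) $ (2*y+4) > 0" "telescoped L y (2*L) $ (2*y+3) > 0" if "L \<ge> 2"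
  proof -
    have p: "(\<Prod>m<2. split_factor L (low_term y) m) = (1 + fps_X) * (1 + fps_X ^ (y+2))"
      using that by (simp add: numeral_2_eq_2 split_factor_def low_term_def)
    have "(\<Prod>m<2. split_factor L (low_term y) m) $ i > 0" if "i = 0 \<or> i = 1" for i
      unfolding p using that by (auto simp: algebra_simps)
    then have t3: "telescoped L y (Suc 2) $ (i + (2*(y+1)+1)) > 0" if "i = 0 \<or> i = 1" for i
      using that factor_diff_quot_pos(1)[OF assms(2), of L 2] by (intro right) blast+
    have "Suc 2 \<le> 2 * L" using that by simp
    note up3 = telescoped_pos_mono[OF assms(2) _ this]
    have "0 + (2*(y+1)+1) = 2*y+3" "1 + (2*(y+1)+1) = 2*y+4" by simp_all
    then show "telescoped L y (2*L) $ (2*y+4) > 0" "telescoped L y (2*L) $ (2*y+3) > 0"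
      using up3[OF t3[of 0]] up3[OF t3[of 1]] by metis+
  qed
  show "telescoped L y (2*L) $ (2*y+4) > 0" "L \<ge> 2 \<Longrightarrow> telescoped L y (2*L) $ (2*y+3) > 0"
    "L = 1 \<Longrightarrow> telescoped L y (2*L) $ (2*y+5) > 0"
    using one ge2 assms by (cases "L = 1"; simp)+
qed

section \<open>Coefficients up to \<open>y + 1\<close>\<close>

lemma fps_mult_nth_cong:
  assumes "\<And>j. j \<le> n \<Longrightarrow> f $ j = f' $ j" "\<And>j. j \<le> n \<Longrightarrow> g $ j = g' $ j"
  shows "(f * g) $ n = (f' * g') $ n"
  unfolding fps_mult_nth by (rule sum.cong) (auto simp: assms)

lemma fps_prod_nth_eq_1:
  assumes "\<And>i j. i \<in> I \<Longrightarrow> j \<le> N \<Longrightarrow> f i $ j = 1 $ j" "n \<le> N"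
  shows "prod f I $ n = 1 $ n"
  using assms
proof (induction I arbitrary: n rule: infinite_finite_induct)
  case (insert i I)
  have "(f i * prod f I) $ n = (1 * 1) $ n"
    using insert by (intro fps_mult_nth_cong) auto
  then show ?case using insert by simp
qed auto

lemma inverse_one_minus_X_power_nth_small:
  "j < k \<Longrightarrow> inverse (1 - fps_X ^ k :: 'a::field fps) $ j = 1 $ j"
  by (auto simp: inverse_one_minus_X_power_nth dest: dvd_imp_le)

text \<open>Stage 1 is exactly u_0 = q, and every u_m and v_m with m >= 1 has exponent above y +
  1.\<close>

lemma telescoped_nth_small:
  assumes "L > 0" "y > 1" "k > 0" "n \<le> y + 1"
  shows "telescoped L y k $ n = fps_X $ n"
  using assms(3,4)
proof (induction k arbitrary: n rule: nat_induct_non_zero)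
  case 1
  then show ?case using assms by (simp add: factor_diff_quot_def low_term_def)
next
  case (Suc k)
  have e: "y + 1 < k*(y+1) + y" "y + 1 < k*(y+1) + 1"
    using Suc assms by (cases k; simp)+
  have "(telescoped L y k * split_factor L (high_term y) k) $ n = (fps_X * 1) $ n"
  proof (rule fps_mult_nth_cong)
    fix j assume "j \<le> n"
    then show "split_factor L (high_term y) k $ j = 1 $ j" using e Suc.prems assms
      by (subst split_factor_X_power_nth[OF high_term_def]) (auto dest: dvd_imp_le)
  qed (use Suc in auto)
  moreover have "((\<Prod>m<k. split_factor L (low_term y) m) * factor_diff_quot L y k) $ n
      = ((\<Prod>m<k. split_factor L (low_term y) m) * 0) $ n"
    using e Suc.prems by (intro fps_mult_nth_cong)
      (auto simp: factor_diff_quot_def low_term_def fps_X_power_mult_nth simp del: power_Suc)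
  ultimately show ?case by simp
qed

text \<open>The least exponent occurring in the factors is 2y, which exceeds y + 1.\<close>

lemma common_factor_nth_small:
  assumes "y > 1" "odd y" "n \<le> y + 1"
  shows "common_factor L y $ n = 1 $ n"
proof -
  have y: "y \<ge> 3" using assms by presburger
  have "common_factor L y $ n = (1 * 1) $ n"
    unfolding common_factor_def
  proof (intro fps_mult_nth_cong fps_prod_nth_eq_1)
    fix i j assume "i \<in> {1..<L}" "j \<le> y + 1"
    then show "inverse (1 - low_term y i ^ 2) $ j = 1 $ j"
      unfolding low_term_def power_mult [symmetric]
      by (intro inverse_one_minus_X_power_nth_small) (cases i; auto)
  next
    fix i j assume "j \<le> y + 1"
    then show "inverse (1 - high_term y i ^ 2) $ j = 1 $ j"
      unfolding high_term_def power_mult [symmetric] using y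
      by (intro inverse_one_minus_X_power_nth_small) auto
  qed (use assms in auto)
  then show ?thesis by simp
qed

text \<open>Through degree y + 1 only q(1 + q^2 + ... + q^(y-3)) is visible, which produces the
  zeros at y and at the even numbers.\<close>

lemma acoef_small:
  assumes "L > 0" "odd y" "y > 1" "n \<le> y + 1"
  shows "acoef L y n = (if odd n \<and> n < y then 1 else 0)"
proof -
  have "acoef L y n = (even_block y * 1 * fps_X) $ n"
    unfolding acoef_eq[OF assms(1,2)]
    using assms by (intro fps_mult_nth_cong) (auto simp: common_factor_nth_small telescoped_nth_small)
  also have "\<dots> = (if odd n \<and> n < y then 1 else 0)"
  proof (cases n)
    case (Suc k)
    have "even k \<and> k div 2 < (y - 1) div 2 \<longleftrightarrow> odd (Suc k) \<and> Suc k < y"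
      using assms(2) by presburger
    then show ?thesis by (simp add: Suc even_block_nth)
  qed simp
  finally show ?thesis .
qed

section \<open>Nonnegativity, the sporadic zero and the range beyond \<open>y + 1\<close>\<close>

lemma acoef_nonneg:
  assumes "L > 0" "odd y"
  shows "acoef L y n \<ge> 0"
  unfolding acoef_eq[OF assms] using assms
  by (auto intro!: fps_nonneg_nth fps_nonneg_mult even_block_nonneg common_factor_nonneg telescoped_nonneg odd_pos)

text \<open>
  For \<open>L = 1\<close>, \<open>y = 3\<close> the difference is \<open>(q + q\<^sup>5) / ((1 - q\<^sup>5) (1 - q\<^sup>6) (1 - q\<^sup>7))\<close>, so its ninth coefficient
  is the sum of the fourth, third and second ones.
\<close>

lemma acoef_1_3_9: "acoef 1 3 9 = 0"
proof -
  define D where "D = Abs_fps (acoef 1 3)"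
  have D: "D = inverse ((1 - fps_X) * (1 - fps_X ^ 5) * (1 - fps_X ^ 6))
      - inverse ((1 - fps_X ^ 2) * (1 - fps_X ^ 3) * (1 - fps_X ^ 7))"
    unfolding D_def by (rule fps_ext) (simp add: acoef_def qpoch_def)
  let ?P = "(1 - fps_X) * (1 - fps_X ^ 5) * (1 - fps_X ^ 6) :: rat fps"
  let ?Q = "(1 - fps_X ^ 2) * (1 - fps_X ^ 3) * (1 - fps_X ^ 7) :: rat fps"
  have PQ: "?P * inverse ?P = 1" "?Q * inverse ?Q = 1"
    by (rule inverse_mult_eq_1', simp)+
  \<comment> \<open>\<open>?c\<close> is ?P * ?Q without the factors of exponents 5, 6, 7; it is
    cancelled later because its constant term is nonzero.\<close>
  let ?c = "(1 - fps_X) * (1 - fps_X ^ 2) * (1 - fps_X ^ 3) :: rat fps"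
  have "?c * ((p - q) * ((1 - fps_X ^ 5) * (1 - fps_X ^ 6) * (1 - fps_X ^ 7)))
      = (?P * p) * ?Q - ?P * (?Q * q)" for p q
    by algebra
  then have "?c * (D * ((1 - fps_X ^ 5) * (1 - fps_X ^ 6) * (1 - fps_X ^ 7)))
      = (?P * inverse ?P) * ?Q - ?P * (?Q * inverse ?Q)"
    unfolding D .
  also have "\<dots> = ?c * (fps_X + fps_X ^ 5)"
    unfolding PQ by algebra
  finally have c: "?c * (D * ((1 - fps_X ^ 5) * (1 - fps_X ^ 6) * (1 - fps_X ^ 7)))
      = ?c * (fps_X + fps_X ^ 5)" .
  have "?c $ 0 \<noteq> 0" by simp
  then have "?c \<noteq> 0" by (metis fps_zero_nth)
  with c have "D * ((1 - fps_X ^ 5) * (1 - fps_X ^ 6) * (1 - fps_X ^ 7)) = fps_X + fps_X ^ 5"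
    by (rule mult_left_cancel[THEN iffD1, rotated])
  moreover have "(1 - fps_X ^ 5) * (1 - fps_X ^ 6) * (1 - fps_X ^ 7) = (1 - fps_X ^ 5 - fps_X ^ 6
      - fps_X ^ 7 + fps_X ^ 11 + fps_X ^ 12 + fps_X ^ 13 - fps_X ^ 18 :: rat fps)"
    by algebra
  ultimately have "(D * (1 - fps_X ^ 5 - fps_X ^ 6 - fps_X ^ 7 + fps_X ^ 11 + fps_X ^ 12
      + fps_X ^ 13 - fps_X ^ 18)) $ 9 = (fps_X + fps_X ^ 5) $ 9"
    by simp
  then have "D $ 9 - D $ 4 - D $ 3 - D $ 2 = 0"
    by (simp add: right_diff_distrib distrib_left fps_X_power_mult_right_nth)
  \<comment> \<open>For y = 3 the coefficients at 2, 3 and 4 vanish by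
    \<open>acoef_small\<close>.\<close>
  then show ?thesis by (simp add: D_def acoef_small)
qed

text \<open>Each support exponent t yields the run t, t+2, ..., t+y-3 through
  \<open>even_block\<close>, and multiples of 2y are free. So it suffices to cover the residues
  modulo 2y by such runs, watching where each class starts.\<close>

lemma acoef_large_pos:
  assumes "L > 0" "odd y" "y > 1" "n > y + 1" "(L, y, n) \<noteq> (1, 3, 9)"
  shows "acoef L y n > 0"
proof -
  obtain z where y: "y = 2*z + 1" and z: "z > 0"
    using assms by (auto elim!: oddE)
  have y0: "y > 0" using y by simp
  note sup = telescoped_support[OF assms(1) y0]
  note pos = acoef_pos[OF assms(1,2)]
  show ?thesis
  proof (cases "even n")
    case True
    \<comment> \<open>The even numbers \<open>y + 3, \<dots>, 3y + 1\<close> represent all even residues modulo \<open>2y\<close>.\<close>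
    define c r where "c = (n - (2*z+4)) div (2*y)" and "r = (n - (2*z+4)) mod (2*y)"
    have n4: "n \<ge> 2*z+4" using True assms y by presburger
    have "c * (2*y) + r = n - (2*z+4)"
      unfolding c_def r_def by (rule div_mult_mod_eq)
    then have n: "n = 2*z + 4 + r + c * (2*y)"
      using n4 by linarith
    have r: "r < 4*z+2" unfolding r_def y by simp
    have "even r" using True n by simp
    then obtain s where s: "r = 2*s" by (auto elim: evenE)
    consider "s < z" | "s = z" | "s > z" by linarith
    then show ?thesis
    proof cases
      case 1
      show ?thesis by (rule pos[OF sup(3), of s _ c]) (use 1 n s y in auto)
    next
      case 2
      show ?thesis by (rule pos[OF sup(4), of 0 _ c]) (use 2 n s y z in auto)
    next
      case 3
      show ?thesis by (rule pos[OF sup(5), of "s-z-1" _ c]) (use 3 n s y r in auto)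
    qed
  next
    case False
    \<comment> \<open>The runs from 1 and from y + 2 cover all odd residues modulo 2y except
      y.\<close>
    define c r where "c = n div (2*y)" and "r = n mod (2*y)"
    have n: "n = r + c * (2*y)"
      unfolding c_def r_def by (rule mod_div_mult_eq [symmetric])
    have r: "r < 4*z+2" unfolding r_def y by simp
    have "odd r" using False n by simp
    then obtain s where s: "r = 2*s+1" by (auto elim: oddE)
    consider "s < z" | "s = z" | "s > z" by linarith
    then show ?thesis
    proof cases
      case 1
      show ?thesis by (rule pos[OF sup(1), of s _ c]) (use 1 n s y in auto)
    next
      case 2
      \<comment> \<open>As n > y + 1, the class of y begins at 3y. The run from 2y + 3 (L >= 2) or
        from 2y + 5 (L = 1, y >= 5) ends at or passes through 3y.\<close>
      then have "c \<noteq> 0" using n s y assms(4) by (cases c) auto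
      then obtain c' where c': "c = Suc c'" using not0_implies_Suc by blast
      consider "L \<ge> 2" | "L = 1" "z \<ge> 2" | "L = 1" "z = 1" using assms z by linarith
      then show ?thesis
      proof cases
        case 1
        show ?thesis by (rule pos[OF sup(6)[OF 1], of "z-1" _ c']) (use 2 c' n s y z in auto)
      next
        case b: 2
        show ?thesis by (rule pos[OF sup(7)[OF b(1)], of "z-2" _ c']) (use 2 b c' n s y z in auto)
      next
        case b: 3
        \<comment> \<open>Here y = 3 and n = 9 is the excluded triple; the next member of the class
          is 15 = 4y + 3.\<close>
        then have "c' \<noteq> 0" using n s y assms(5) c' 2 by (cases c') auto
        then obtain d where d: "c' = Suc d" using not0_implies_Suc by blast
        show ?thesis by (rule pos[OF sup(8)[OF b(1)], of 0 _ d]) (use 2 b c' d n s y z in auto)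
      qed
    next
      case 3
      show ?thesis by (rule pos[OF sup(2), of "s-z-1" _ c]) (use 3 n s y r in auto)
    qed
  qed
qed

theorem theorem3:
  fixes L y :: nat
  assumes "L > 0" and "odd y" and "y > 1"
  shows "(\<forall>n\<ge>1. acoef L y n \<ge> 0) \<and>
         (\<forall>n\<ge>1. acoef L y n = 0 \<longleftrightarrow>
             ((even n \<and> 2 \<le> n \<and> n \<le> y + 1) \<or> n = y \<or> (L, y, n) = (1, 3, 9)))"
proof (intro conjI allI impI)
  fix n :: nat assume "n \<ge> 1"
  show "acoef L y n \<ge> 0" using assms by (simp add: acoef_nonneg)
  show "acoef L y n = 0 \<longleftrightarrow>
      ((even n \<and> 2 \<le> n \<and> n \<le> y + 1) \<or> n = y \<or> (L, y, n) = (1, 3, 9))"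
  proof (cases "n \<le> y + 1")
    case True
    have "odd n \<and> n < y \<longleftrightarrow> \<not> ((even n \<and> 2 \<le> n \<and> n \<le> y + 1) \<or> n = y)"
      using True \<open>n \<ge> 1\<close> assms by presburger
    moreover have "(L, y, n) \<noteq> (1, 3, 9)" using True by auto
    moreover have "acoef L y n = 0 \<longleftrightarrow> \<not> (odd n \<and> n < y)"
      using acoef_small[OF assms True] by simp
    ultimately show ?thesis by blast
  next
    case False
    show ?thesis
    proof (cases "(L, y, n) = (1, 3, 9)")
      case True
      then show ?thesis using acoef_1_3_9 by simp
    next
      case neq: False
      then show ?thesis using acoef_large_pos[OF assms _ neq] False assms by auto
    qed
  qed
qed

end
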